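(* Let $\mathcal{X}$ be a set, let $\mathcal{U}$ and $\mathcal{V}$ be two sets paired by a coupling $c:\mathcal{U}\times\mathcal{V}\to\overline{\mathbb{R}}$, and let $L:\mathcal{X}\times\mathcal{V}\to\overline{\mathbb{R}}$ be a function (a Lagrangian). Define the Rockafellian $R:\mathcal{X}\times\mathcal{U}\to\overline{\mathbb{R}}$ by $$R(x,u)=\sup_{v\in\mathcal{V}}\Big(L(x,v)\underset{\cdot}{+}c(u,v)\Big)\quad\forall (x,u)\in\mathcal{X}\times\mathcal{U},$$ and define the perturbation function $\varphi:\mathcal{U}\to\overline{\mathbb{R}}$ and the dual function $\psi:\mathcal{V}\to\overline{\mathbb{R}}$ by $$\varphi(u)=\inf_{x\in\mathcal{X}}R(x,u)\quad\forall u\in\mathcal{U},\qquad \psi(v)=\inf_{x\in\mathcal{X}}L(x,v)\quad\forall v\in\mathcal{V}.$$ Then, for all $x\in\mathcal{X}$, $R(x,\cdot)=\big(-L(x,\cdot)\big)^{c'}$ and $R(x,\cdot)$ is $c$-convex; moreover, $\varphi\geq(-\psi)^{c'}$ pointwise on $\mathcal{U}$.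
   Context: $\overline{\mathbb{R}}=[-\infty,+\infty]$. The Moreau lower addition $\underset{\cdot}{+}$ extends the usual addition to $\overline{\mathbb{R}}$ with $(+\infty)\underset{\cdot}{+}(-\infty)=(-\infty)\underset{\cdot}{+}(+\infty)=-\infty$. A coupling between sets $\mathcal{U}$ and $\mathcal{V}$ is any function $c:\mathcal{U}\times\mathcal{V}\to\overline{\mathbb{R}}$. For $f:\mathcal{U}\to\overline{\mathbb{R}}$, the $c$-Fenchel-Moreau conjugate $f^{c}:\mathcal{V}\to\overline{\mathbb{R}}$ is $f^{c}(v)=\sup_{u\in\mathcal{U}}\big(c(u,v)\underset{\cdot}{+}(-f(u))\big)$. For $g:\mathcal{V}\to\overline{\mathbb{R}}$, the $c'$-Fenchel-Moreau conjugate $g^{c'}:\mathcal{U}\to\overline{\mathbb{R}}$ is $g^{c'}(u)=\sup_{v\in\mathcal{V}}\big(c(u,v)\underset{\cdot}{+}(-g(v))\big)$. The biconjugate of $f$ is $f^{cc'}=(f^{c})^{c'}$. A function $f:\mathcal{U}\to\overline{\mathbb{R}}$ is $c$-convex if $f^{cc'}=f$. For $x\in\mathcal{X}$, $L(x,\cdot):\mathcal{V}\to\overline{\mathbb{R}}$ and $R(x,\cdot):\mathcal{U}\to\overline{\mathbb{R}}$ denote the partial functions with $x$ fixed. *)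

theory Defs
  imports "HOL-Library.Extended_Real"
begin

(* Library addition on ereal satisfies \<infinity> + (-\<infinity>) = \<infinity>, so it is the Moreau upper
   addition; the lower addition must be defined separately. *)
definition lower_add :: "ereal \<Rightarrow> ereal \<Rightarrow> ereal"  (infixl \<open>+\<^sub>L\<close> 65) where
  "a +\<^sub>L b = (if a = -\<infinity> \<or> b = -\<infinity> then -\<infinity> else a + b)"

(* Sets are carriers inside types, so that they may be empty; only the values of functions on
   the carriers matter, and equality of functions is pointwise equality on the carrier. *)

definition fm_conjugate ::
    "'u set \<Rightarrow> ('u \<Rightarrow> 'v \<Rightarrow> ereal) \<Rightarrow> ('u \<Rightarrow> ereal) \<Rightarrow> 'v \<Rightarrow> ereal" where
  "fm_conjugate U c f v = (SUP u\<in>U. c u v +\<^sub>L (- f u))"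

definition fm_conjugate' ::
    "'v set \<Rightarrow> ('u \<Rightarrow> 'v \<Rightarrow> ereal) \<Rightarrow> ('v \<Rightarrow> ereal) \<Rightarrow> 'u \<Rightarrow> ereal" where
  "fm_conjugate' V c g u = (SUP v\<in>V. c u v +\<^sub>L (- g v))"

definition fm_biconjugate ::
    "'u set \<Rightarrow> 'v set \<Rightarrow> ('u \<Rightarrow> 'v \<Rightarrow> ereal) \<Rightarrow> ('u \<Rightarrow> ereal) \<Rightarrow> 'u \<Rightarrow> ereal" where
  "fm_biconjugate U V c f = fm_conjugate' V c (fm_conjugate U c f)"

definition c_convex ::
    "'u set \<Rightarrow> 'v set \<Rightarrow> ('u \<Rightarrow> 'v \<Rightarrow> ereal) \<Rightarrow> ('u \<Rightarrow> ereal) \<Rightarrow> bool" where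
  "c_convex U V c f \<longleftrightarrow> (\<forall>u\<in>U. fm_biconjugate U V c f u = f u)"

definition rockafellian ::
    "'v set \<Rightarrow> ('u \<Rightarrow> 'v \<Rightarrow> ereal) \<Rightarrow> ('x \<Rightarrow> 'v \<Rightarrow> ereal) \<Rightarrow> 'x \<Rightarrow> 'u \<Rightarrow> ereal" where
  "rockafellian V c L x u = (SUP v\<in>V. L x v +\<^sub>L c u v)"

definition perturbation_function ::
    "'x set \<Rightarrow> ('x \<Rightarrow> 'u \<Rightarrow> ereal) \<Rightarrow> 'u \<Rightarrow> ereal" where
  "perturbation_function X R u = (INF x\<in>X. R x u)"

definition dual_function ::
    "'x set \<Rightarrow> ('x \<Rightarrow> 'v \<Rightarrow> ereal) \<Rightarrow> 'v \<Rightarrow> ereal" where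
  "dual_function X L v = (INF x\<in>X. L x v)"

end

theory Submission
  imports Defs
begin

text \<open>Everything rests on \<open>a +\<^sub>L - (a +\<^sub>L - b) \<le> b\<close>, valid also at infinite values. It gives
  \<open>f\<^sup>c\<^sup>c\<^sup>' \<le> f\<close> and, with the roles of the two sets exchanged, \<open>g\<^sup>c\<^sup>'\<^sup>c \<le> g\<close>; since conjugation
  is antitone, the latter yields \<open>g\<^sup>c\<^sup>' \<le> g\<^sup>c\<^sup>'\<^sup>c\<^sup>c\<^sup>'\<close>, so every \<open>c'\<close>-conjugate is \<open>c\<close>-convex. Antitonicity
  applied to \<open>\<psi> \<le> L(x, \<cdot>)\<close> gives the bound on \<open>\<phi>\<close>.\<close>

lemma lower_add_commute: "a +\<^sub>L b = b +\<^sub>L a"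
  by (simp add: lower_add_def add.commute)

lemma lower_add_left_mono: "b \<le> b' \<Longrightarrow> a +\<^sub>L b \<le> a +\<^sub>L b'"
  by (auto simp: lower_add_def intro: add_left_mono)

text \<open>For finite \<open>a\<close> this is an equality, and for \<open>a = -\<infinity>\<close>
  the left side is \<open>-\<infinity>\<close>. For \<open>a = \<infinity>\<close> it is again
  \<open>-\<infinity>\<close> unless \<open>b = \<infinity>\<close>; upper addition would fail here
  for finite \<open>b\<close>.\<close>

lemma lower_add_uminus_lower_add_le: "a +\<^sub>L - (a +\<^sub>L - b) \<le> b"
  by (cases a; cases b) (auto simp: lower_add_def)

lemma fm_conjugate'_antimono:
  assumes "\<And>v. v \<in> V \<Longrightarrow> g v \<le> h v"
  shows "fm_conjugate' V c h u \<le> fm_conjugate' V c g u"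
  unfolding fm_conjugate'_def by (rule SUP_mono) (auto intro!: bexI lower_add_left_mono simp: assms)

lemma fm_biconjugate_le:
  assumes "u \<in> U"
  shows "fm_biconjugate U V c f u \<le> f u"
  unfolding fm_biconjugate_def fm_conjugate'_def
proof (rule SUP_least)
  fix v
  have "c u v +\<^sub>L - f u \<le> fm_conjugate U c f v"
    unfolding fm_conjugate_def using assms by (rule SUP_upper)
  \<comment> \<open>Negation turns the lower bound on the supremum into an upper bound.\<close>
  then have "c u v +\<^sub>L - fm_conjugate U c f v \<le> c u v +\<^sub>L - (c u v +\<^sub>L - f u)"
    by (simp add: lower_add_left_mono)
  also have "\<dots> \<le> f u" by (rule lower_add_uminus_lower_add_le)
  finally show "c u v +\<^sub>L - fm_conjugate U c f v \<le> f u" .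
qed

lemma fm_conjugate_fm_conjugate'_le:
  assumes "v \<in> V"
  shows "fm_conjugate U c (fm_conjugate' V c g) v \<le> g v"
  unfolding fm_conjugate_def
proof (rule SUP_least)
  fix u
  have "c u v +\<^sub>L - g v \<le> fm_conjugate' V c g u"
    unfolding fm_conjugate'_def using assms by (rule SUP_upper)
  then have "c u v +\<^sub>L - fm_conjugate' V c g u \<le> c u v +\<^sub>L - (c u v +\<^sub>L - g v)"
    by (simp add: lower_add_left_mono)
  also have "\<dots> \<le> g v" by (rule lower_add_uminus_lower_add_le)
  finally show "c u v +\<^sub>L - fm_conjugate' V c g u \<le> g v" .
qed

lemma c_convex_fm_conjugate': "c_convex U V c (fm_conjugate' V c g)"
  unfolding c_convex_def
proof (intro ballI antisym)
  fix u assume "u \<in> U"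
  then show "fm_biconjugate U V c (fm_conjugate' V c g) u \<le> fm_conjugate' V c g u"
    by (rule fm_biconjugate_le)
  show "fm_conjugate' V c g u \<le> fm_biconjugate U V c (fm_conjugate' V c g) u"
    unfolding fm_biconjugate_def
    by (intro fm_conjugate'_antimono fm_conjugate_fm_conjugate'_le)
qed

text \<open>The two negations cancel. Equality as functions allows rewriting inside
  \<open>c_convex\<close>.\<close>

lemma rockafellian_eq_fm_conjugate': "rockafellian V c L x = fm_conjugate' V c (\<lambda>v. - L x v)"
  by (simp add: fun_eq_iff rockafellian_def fm_conjugate'_def lower_add_commute)

lemma fm_conjugate'_dual_function_le:
  "fm_conjugate' V c (\<lambda>v. - dual_function X L v) u
    \<le> perturbation_function X (rockafellian V c L) u"
  unfolding perturbation_function_def rockafellian_eq_fm_conjugate'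
  \<comment> \<open>Each \<open>x\<close> is bounded separately, from
    \<open>- L x v \<le> - dual_function X L v\<close>; for empty \<open>X\<close> the infimum is
    \<open>\<infinity>\<close>.\<close>
  by (intro INF_greatest fm_conjugate'_antimono) (auto simp: dual_function_def intro: INF_lower)

theorem proposition2:
  fixes X :: "'x set" and U :: "'u set" and V :: "'v set"
    and c :: "'u \<Rightarrow> 'v \<Rightarrow> ereal"
    and L :: "'x \<Rightarrow> 'v \<Rightarrow> ereal"
    and R :: "'x \<Rightarrow> 'u \<Rightarrow> ereal"
    and \<phi> :: "'u \<Rightarrow> ereal"
    and \<psi> :: "'v \<Rightarrow> ereal"
  defines "R \<equiv> rockafellian V c L"
    and "\<phi> \<equiv> perturbation_function X R"
    and "\<psi> \<equiv> dual_function X L"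
  shows "(\<forall>x\<in>X. (\<forall>u\<in>U. R x u = fm_conjugate' V c (\<lambda>v. - L x v) u) \<and> c_convex U V c (R x))
    \<and> (\<forall>u\<in>U. \<phi> u \<ge> fm_conjugate' V c (\<lambda>v. - \<psi> v) u)"
  unfolding R_def \<phi>_def \<psi>_def
  using fm_conjugate'_dual_function_le[of V c X L]
  by (simp add: rockafellian_eq_fm_conjugate' c_convex_fm_conjugate')

end
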